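(* Let $G_1$ and $G_2$ be disjoint cubic graphs with $4$-total colorings $\mathcal{C}_1$ and $\mathcal{C}_2$, respectively, over the color set $\{1,2,3,4\}$, and let $u_1v_1 \in E(G_1)$ and $u_2v_2 \in E(G_2)$. Then there exists a permutation $\pi$ of $\{1,2,3,4\}$ such that \[ \pi\bigl(\mathcal{C}_2(u_2v_2)\bigr) = \mathcal{C}_1(u_1v_1), \qquad \pi\bigl(\mathcal{C}_2(u_2)\bigr) \neq \mathcal{C}_1(u_1), \qquad \pi\bigl(\mathcal{C}_2(v_2)\bigr) \neq \mathcal{C}_1(v_1). \] For every such $\pi$, the graph \[ G_1 \oplus G_2 \;=\; \bigl(G_1 \cup G_2\bigr) - \{u_1v_1,\, u_2v_2\} + \{u_1u_2,\, v_1v_2\} \] (obtained from the disjoint union by deleting the edges $u_1v_1,u_2v_2$ and adding the edges $u_1u_2,v_1v_2$) is a simple cubic graph, connected whenever $G_1$ and $G_2$ are connected and at least one of $u_1v_1$, $u_2v_2$ is not a bridge (of $G_1$, respectively $G_2$), and the assignment $\mathcal{C}$ that coincides with $\mathcal{C}_1$ on the remaining elements of $G_1$, with $\pi \circ \mathcal{C}_2$ on the remaining elements of $G_2$, and that assigns the color $\mathcal{C}_1(u_1v_1)$ to both new edges $u_1u_2$ and $v_1v_2$, is a $4$-total coloring of $G_1 \oplus G_2$. Moreover, for each color $i$, the class of color $i$ in $\mathcal{C}$ has cardinality equal to the sum of the cardinalities of the class of color $i$ in $\mathcal{C}_1$ and of the class of color $i$ in $\pi \circ \mathcal{C}_2$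.
   Context: All graphs are finite, simple and cubic ($3$-regular), not necessarily connected unless stated. The elements of a graph are its vertices and edges. A $4$-total coloring of $G$ assigns one of the four colors $1,2,3,4$ to each vertex and each edge of $G$ so that adjacent vertices receive distinct colors, adjacent edges (edges sharing an endpoint) receive distinct colors, and every vertex and edge that are incident receive distinct colors. The class of color $i$ is the set of all elements of color $i$. *)

theory Defs
  imports Main "HOL-Combinatorics.Permutations"
begin

record 'a ugraph =
  verts :: "'a set"
  edges :: "'a set set"

definition simple_graph :: "'a ugraph \<Rightarrow> bool" where
  "simple_graph G \<longleftrightarrow> finite (verts G) \<and> (\<forall>e\<in>edges G. e \<subseteq> verts G \<and> card e = 2)"

definition degree :: "'a ugraph \<Rightarrow> 'a \<Rightarrow> nat" where
  "degree G v = card {e \<in> edges G. v \<in> e}"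

definition cubic_graph :: "'a ugraph \<Rightarrow> bool" where
  "cubic_graph G \<longleftrightarrow> simple_graph G \<and> (\<forall>v\<in>verts G. degree G v = 3)"

definition graph_union :: "'a ugraph \<Rightarrow> 'a ugraph \<Rightarrow> 'a ugraph" where
  "graph_union G H = \<lparr>verts = verts G \<union> verts H, edges = edges G \<union> edges H\<rparr>"

definition delete_edges :: "'a ugraph \<Rightarrow> 'a set set \<Rightarrow> 'a ugraph" where
  "delete_edges G F = \<lparr>verts = verts G, edges = edges G - F\<rparr>"

definition add_edges :: "'a ugraph \<Rightarrow> 'a set set \<Rightarrow> 'a ugraph" where
  "add_edges G F = \<lparr>verts = verts G, edges = edges G \<union> F\<rparr>"

definition adjacency :: "'a ugraph \<Rightarrow> ('a \<times> 'a) set" where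
  "adjacency G = {(u, v). {u, v} \<in> edges G}"

definition connected_graph :: "'a ugraph \<Rightarrow> bool" where
  "connected_graph G \<longleftrightarrow>
     verts G \<noteq> {} \<and> (\<forall>u\<in>verts G. \<forall>v\<in>verts G. (u, v) \<in> (adjacency G)\<^sup>*)"

definition graph_components :: "'a ugraph \<Rightarrow> 'a set set" where
  "graph_components G = (\<lambda>u. {v \<in> verts G. (u, v) \<in> (adjacency G)\<^sup>*}) ` verts G"

definition bridge :: "'a ugraph \<Rightarrow> 'a set \<Rightarrow> bool" where
  "bridge G e \<longleftrightarrow>
     e \<in> edges G \<and> card (graph_components (delete_edges G {e})) > card (graph_components G)"

datatype 'a element = Vertex 'a | Edge "'a set"

definition elements :: "'a ugraph \<Rightarrow> 'a element set" where
  "elements G = Vertex ` verts G \<union> Edge ` edges G"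

text \<open>A colouring is a total function; only its values on \<^const>\<open>elements\<close> matter.\<close>

definition total_coloring :: "nat \<Rightarrow> 'a ugraph \<Rightarrow> ('a element \<Rightarrow> nat) \<Rightarrow> bool" where
  "total_coloring k G C \<longleftrightarrow>
     (\<forall>x\<in>elements G. C x \<in> {1..k}) \<and>
     (\<forall>u v. {u, v} \<in> edges G \<longrightarrow> C (Vertex u) \<noteq> C (Vertex v)) \<and>
     (\<forall>e\<in>edges G. \<forall>f\<in>edges G. e \<noteq> f \<and> e \<inter> f \<noteq> {} \<longrightarrow> C (Edge e) \<noteq> C (Edge f)) \<and>
     (\<forall>e\<in>edges G. \<forall>v\<in>e. C (Vertex v) \<noteq> C (Edge e))"

definition color_class :: "'a ugraph \<Rightarrow> ('a element \<Rightarrow> nat) \<Rightarrow> nat \<Rightarrow> 'a element set" where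
  "color_class G C i = {x \<in> elements G. C x = i}"

definition edge_splice ::
    "'a ugraph \<Rightarrow> 'a \<Rightarrow> 'a \<Rightarrow> 'a ugraph \<Rightarrow> 'a \<Rightarrow> 'a \<Rightarrow> 'a ugraph" where
  "edge_splice G1 u1 v1 G2 u2 v2 =
     add_edges (delete_edges (graph_union G1 G2) {{u1, v1}, {u2, v2}}) {{u1, u2}, {v1, v2}}"

text \<open>\<open>C2\<close> is used as given: the permuted colouring of the second graph has to be passed here.\<close>

definition splice_coloring ::
    "'a ugraph \<Rightarrow> ('a element \<Rightarrow> nat) \<Rightarrow> 'a \<Rightarrow> 'a \<Rightarrow> ('a element \<Rightarrow> nat) \<Rightarrow> 'a \<Rightarrow> 'a
       \<Rightarrow> 'a element \<Rightarrow> nat" where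
  "splice_coloring G1 C1 u1 v1 C2 u2 v2 x =
     (if x = Edge {u1, u2} \<or> x = Edge {v1, v2} then C1 (Edge {u1, v1})
      else if x \<in> elements G1 then C1 x
      else C2 x)"

end

(* The new edges inherit the colour of the deleted ones, and at each of the four ends one new edge
   takes the place of one deleted edge.  Hence every vertex sees the same coloured star as before,
   which gives 3-regularity and all conflicts involving edges; only the ends of the new edges
   have to be compared.  For connectedness, if u1v1 is not a bridge, then the path
   u2, u1, ..., v1, v2 through the connected graph G1 - u1v1 replaces the deleted edge u2v2. *)
theory Submission
  imports Defs
begin

section \<open>Simple graphs, total colorings and permutations of the colors\<close>

lemma simple_graph_finite_edges: "simple_graph G \<Longrightarrow> finite (edges G)"
  unfolding simple_graph_def by (meson Pow_iff finite_Pow_iff finite_subset subsetI)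

lemma finite_elements: "simple_graph G \<Longrightarrow> finite (elements G)"
  using simple_graph_finite_edges by (auto simp: elements_def simple_graph_def)

lemma simple_graph_edgeD:
  assumes "simple_graph G" and "{u, v} \<in> edges G"
  shows "u \<in> verts G" "v \<in> verts G" "u \<noteq> v"
  using assms unfolding simple_graph_def by (auto dest!: bspec)

lemma total_coloringD:
  assumes "total_coloring k G C"
  shows "z \<in> elements G \<Longrightarrow> C z \<in> {1..k}"
    and "{u, v} \<in> edges G \<Longrightarrow> C (Vertex u) \<noteq> C (Vertex v)"
    and "e \<in> edges G \<Longrightarrow> f \<in> edges G \<Longrightarrow> v \<in> e \<Longrightarrow> v \<in> f \<Longrightarrow> e \<noteq> f \<Longrightarrow> C (Edge e) \<noteq> C (Edge f)"
    and "e \<in> edges G \<Longrightarrow> v \<in> e \<Longrightarrow> C (Vertex v) \<noteq> C (Edge e)"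
proof -
  note * = assms[unfolded total_coloring_def]
  show "z \<in> elements G \<Longrightarrow> C z \<in> {1..k}" by (rule bspec[OF conjunct1[OF *]])
  show "{u, v} \<in> edges G \<Longrightarrow> C (Vertex u) \<noteq> C (Vertex v)" using * by simp
  show "C (Edge e) \<noteq> C (Edge f)"
    if "e \<in> edges G" "f \<in> edges G" "v \<in> e" "v \<in> f" "e \<noteq> f"
  proof -
    have "e \<inter> f \<noteq> {}" using that by auto
    with * that show ?thesis by simp
  qed
  show "e \<in> edges G \<Longrightarrow> v \<in> e \<Longrightarrow> C (Vertex v) \<noteq> C (Edge e)" using * by simp
qed

text \<open>The conditions only compare colors or ask for membership in the color set, and a
  permutation of that set respects both.\<close>

lemma total_coloring_permute:
  assumes "total_coloring k G C" and "\<pi> permutes {1..k}"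
  shows "total_coloring k G (\<pi> \<circ> C)"
proof -
  have inj: "\<pi> x = \<pi> y \<longleftrightarrow> x = y" for x y
    using permutes_inj[OF assms(2)] by (rule inj_eq)
  note * = assms(1)[unfolded total_coloring_def]
  show ?thesis
    \<comment> \<open>Rewriting with injectivity and invariance of \<open>{1..k}\<close> turns the
      goal literally into the hypothesis.\<close>
    unfolding total_coloring_def o_apply inj permutes_in_image[OF assms(2)] by (rule *)
qed

text \<open>Two transpositions suffice: the first sends \<open>a\<close> to \<open>a'\<close>, the
  second sends the image of \<open>b\<close> to \<open>b'\<close>. This serves to prescribe the
  color of an edge and of one of its ends.\<close>

lemma exists_permutes_two_values:
  assumes "a \<in> S" "a' \<in> S" "b \<in> S" "b' \<in> S" "a \<noteq> b" "a' \<noteq> b'"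
  obtains \<pi> where "\<pi> permutes S" "\<pi> a = a'" "\<pi> b = b'"
proof
  let ?\<tau> = "transpose a a'"
  have perm: "?\<tau> permutes S" using assms by (intro permutes_swap_id)
  moreover have "?\<tau> b \<in> S" using assms permutes_in_image[OF perm] by blast
  ultimately show "transpose (?\<tau> b) b' \<circ> ?\<tau> permutes S"
    using assms by (intro permutes_compose permutes_swap_id)
  \<comment> \<open>As \<open>a'\<close> is the image of \<open>a\<close> alone and also differs
    from \<open>b'\<close>, the second transposition fixes it.\<close>
  have "?\<tau> b \<noteq> a'" using \<open>a \<noteq> b\<close> by (auto simp: transpose_def)
  then show "(transpose (?\<tau> b) b' \<circ> ?\<tau>) a = a'" using \<open>a' \<noteq> b'\<close> by simp
  show "(transpose (?\<tau> b) b' \<circ> ?\<tau>) b = b'" by simp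
qed

section \<open>Connectedness, components and bridges\<close>

lemma sym_adjacency: "sym (adjacency G)"
  by (auto simp: sym_def adjacency_def insert_commute)

lemma adjacency_rtrancl_sym: "(u, v) \<in> (adjacency G)\<^sup>* \<Longrightarrow> (v, u) \<in> (adjacency G)\<^sup>*"
  by (metis sym_adjacency sym_rtrancl symD)

lemma card_graph_components_connected:
  assumes "connected_graph G"
  shows "card (graph_components G) = 1"
proof -
  have "graph_components G = {verts G}"
    using assms unfolding graph_components_def connected_graph_def by auto
  then show ?thesis by simp
qed

lemma connected_graph_if_card_components_le_1:
  assumes "finite (verts G)" "verts G \<noteq> {}" "card (graph_components G) \<le> 1"
  shows "connected_graph G"
  unfolding connected_graph_def
proof (intro conjI ballI)
  fix u v assume uv: "u \<in> verts G" "v \<in> verts G"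
  let ?K = "\<lambda>u. {v \<in> verts G. (u, v) \<in> (adjacency G)\<^sup>*}"
  \<comment> \<open>Finiteness gives the bound its meaning, since \<open>card\<close> of an infinite
    set is 0. With at most one component, those of \<open>u\<close> and \<open>v\<close>
    coincide.\<close>
  have "finite (graph_components G)" using assms(1) by (simp add: graph_components_def)
  moreover have "?K u \<in> graph_components G" "?K v \<in> graph_components G"
    using uv by (auto simp: graph_components_def)
  ultimately have "?K u = ?K v" using assms(3) by (metis card_le_Suc0_iff_eq One_nat_def)
  then show "(u, v) \<in> (adjacency G)\<^sup>*" using uv by blast
qed (fact assms(2))

text \<open>Bridges are defined by counting components: \<open>G\<close> has exactly one, so
  removing an edge that is not a bridge leaves at most one.\<close>

lemma connected_delete_non_bridge:
  assumes "simple_graph G" "connected_graph G" "e \<in> edges G" "\<not> bridge G e"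
  shows "connected_graph (delete_edges G {e})"
proof (rule connected_graph_if_card_components_le_1)
  show "card (graph_components (delete_edges G {e})) \<le> 1"
    using assms card_graph_components_connected[of G] by (simp add: bridge_def)
qed (use assms in \<open>auto simp: delete_edges_def simple_graph_def connected_graph_def\<close>)

section \<open>Vertices, edges and elements of the spliced graph\<close>

locale splice =
  fixes G1 :: "'a ugraph" and u1 v1 :: 'a and G2 :: "'a ugraph" and u2 v2 :: 'a
  assumes simple1: "simple_graph G1" and simple2: "simple_graph G2"
    and disjoint: "verts G1 \<inter> verts G2 = {}"
    and edge1: "{u1, v1} \<in> edges G1" and edge2: "{u2, v2} \<in> edges G2"
begin

abbreviation G :: "'a ugraph" where
  "G \<equiv> edge_splice G1 u1 v1 G2 u2 v2"

lemma verts_G: "verts G = verts G1 \<union> verts G2"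
  by (simp add: edge_splice_def add_edges_def delete_edges_def graph_union_def)

lemma edges_G:
  "edges G = (edges G1 \<union> edges G2 - {{u1, v1}, {u2, v2}}) \<union> {{u1, u2}, {v1, v2}}"
  by (simp add: edge_splice_def add_edges_def delete_edges_def graph_union_def)

text \<open>The setting is symmetric in the two graphs. Together with
  \<open>edge_splice_swap\<close> this carries every fact proved on the side of \<open>G1\<close>
  over to the side of \<open>G2\<close>.\<close>

lemma swap: "splice G2 u2 v2 G1 u1 v1"
  using simple1 simple2 disjoint edge1 edge2 by unfold_locales auto

lemma edge_splice_swap: "edge_splice G2 u2 v2 G1 u1 v1 = G"
  by (simp add: edge_splice_def add_edges_def delete_edges_def graph_union_def
      Un_commute insert_commute)

lemma ends:
  "u1 \<in> verts G1" "v1 \<in> verts G1" "u1 \<noteq> v1"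
  "u2 \<in> verts G2" "v2 \<in> verts G2" "u2 \<noteq> v2"
  using simple_graph_edgeD simple1 simple2 edge1 edge2 by metis+

lemma ends_notin: "u1 \<notin> verts G2" "v1 \<notin> verts G2" "u2 \<notin> verts G1" "v2 \<notin> verts G1"
  using ends disjoint by auto

lemma ends_distinct: "u1 \<noteq> u2" "v1 \<noteq> v2"
  using ends ends_notin by auto

lemma edges_subset: "e \<in> edges G1 \<Longrightarrow> e \<subseteq> verts G1" "e \<in> edges G2 \<Longrightarrow> e \<subseteq> verts G2"
  using simple1 simple2 by (auto simp: simple_graph_def)

lemma edges_nonempty: "e \<in> edges G1 \<Longrightarrow> e \<noteq> {}" "e \<in> edges G2 \<Longrightarrow> e \<noteq> {}"
  using simple1 simple2 by (auto simp: simple_graph_def)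

lemma edges_disjoint: "edges G1 \<inter> edges G2 = {}"
proof (rule equals0I)
  fix e assume "e \<in> edges G1 \<inter> edges G2"
  then have "e \<subseteq> verts G1 \<inter> verts G2" "e \<noteq> {}"
    using edges_subset edges_nonempty by auto
  then show False using disjoint by simp
qed

text \<open>A new edge has one end on each side, whereas an old edge stays within the vertices of
  its own graph.\<close>

lemma new_edges_notin:
  "{u1, u2} \<notin> edges G1" "{v1, v2} \<notin> edges G1" "{u1, u2} \<notin> edges G2" "{v1, v2} \<notin> edges G2"
  using edges_subset[of "{u1, u2}"] edges_subset[of "{v1, v2}"] ends_notin by auto

text \<open>Both deleted edges are removed from the whole union, but by
  \<open>edges_disjoint\<close> an edge of one graph is never the deleted edge of the other.\<close>

lemma old_edge_in_G:
  "f \<in> edges G1 \<Longrightarrow> f \<noteq> {u1, v1} \<Longrightarrow> f \<in> edges G"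
  "f \<in> edges G2 \<Longrightarrow> f \<noteq> {u2, v2} \<Longrightarrow> f \<in> edges G"
proof -
  have "f \<noteq> {u2, v2}" if "f \<in> edges G1" using that edges_disjoint edge2 by (metis disjoint_iff)
  then show "f \<in> edges G1 \<Longrightarrow> f \<noteq> {u1, v1} \<Longrightarrow> f \<in> edges G" by (simp add: edges_G)
  have "f \<noteq> {u1, v1}" if "f \<in> edges G2" using that edges_disjoint edge1 by (metis disjoint_iff)
  then show "f \<in> edges G2 \<Longrightarrow> f \<noteq> {u2, v2} \<Longrightarrow> f \<in> edges G" by (simp add: edges_G)
qed

lemma elements_G_cases:
  assumes "z \<in> elements G"
  obtains (new) "z = Edge {u1, u2} \<or> z = Edge {v1, v2}"
    | (left) "z \<in> elements G1" | (right) "z \<in> elements G2"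
proof -
  have "z \<in> elements G1 \<union> elements G2 \<union> {Edge {u1, u2}, Edge {v1, v2}}"
    using assms unfolding elements_def verts_G edges_G by (elim UnE imageE DiffE insertE emptyE) simp_all
  then show thesis using that by (elim UnE insertE emptyE) simp_all
qed

lemma simple_G: "simple_graph G"
  using simple1 simple2 ends ends_distinct
  by (auto simp: simple_graph_def verts_G edges_G)

section \<open>Stars and degrees in the spliced graph\<close>

definition unsplice :: "'a set \<Rightarrow> 'a set" where
  "unsplice f = (if f \<in> {{u1, u2}, {v1, v2}} then {u1, v1} else f)"

text \<open>No edge of \<open>G2\<close> reaches a vertex of \<open>G1\<close>, and the new edges
  meet \<open>verts G1\<close> only in \<open>u1\<close> and \<open>v1\<close> respectively.\<close>

lemma star_G_iff:
  assumes "x \<in> verts G1"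
  shows "f \<in> edges G \<and> x \<in> f \<longleftrightarrow>
    f \<in> edges G1 \<and> f \<noteq> {u1, v1} \<and> x \<in> f \<or> f = {u1, u2} \<and> x = u1 \<or> f = {v1, v2} \<and> x = v1"
proof -
  have x: "x \<noteq> u2" "x \<noteq> v2" using assms ends_notin by auto
  have not2: "f \<notin> edges G2" if "x \<in> f" using that assms edges_subset(2) disjoint by blast
  show ?thesis
  proof
    assume "f \<in> edges G \<and> x \<in> f"
    then show "f \<in> edges G1 \<and> f \<noteq> {u1, v1} \<and> x \<in> f \<or> f = {u1, u2} \<and> x = u1 \<or> f = {v1, v2} \<and> x = v1"
      unfolding edges_G using x not2 by (elim conjE UnE DiffE insertE emptyE) simp_all
  next
    have "{u1, u2} \<in> edges G" "{v1, v2} \<in> edges G" by (simp_all add: edges_G)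
    moreover assume "f \<in> edges G1 \<and> f \<noteq> {u1, v1} \<and> x \<in> f \<or> f = {u1, u2} \<and> x = u1 \<or> f = {v1, v2} \<and> x = v1"
    ultimately show "f \<in> edges G \<and> x \<in> f" using old_edge_in_G(1) by (elim disjE conjE) simp_all
  qed
qed

text \<open>Globally \<open>unsplice\<close> merges the two new edges, but a vertex of
  \<open>G1\<close> lies on at most one of them, so on a single star the map is injective. The
  bijection yields the degrees and later transports the edge colors.\<close>

lemma bij_betw_star:
  assumes "x \<in> verts G1"
  shows "bij_betw unsplice {f \<in> edges G. x \<in> f} {e \<in> edges G1. x \<in> e}"
proof -
  \<comment> \<open>Opaque names keep these edges atomic, so the case analyses below do not open
    equations between two-element sets.\<close>
  define e1 f1 f2 where "e1 = {u1, v1}" and "f1 = {u1, u2}" and "f2 = {v1, v2}"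
  \<comment> \<open>The inverse on the star of \<open>x\<close> puts the new edge at
    \<open>x\<close> in place of the deleted one. The value \<open>f2\<close> is relevant for
    \<open>x = v1\<close> only, as \<open>e1\<close> contains no vertex besides \<open>u1\<close>
    and \<open>v1\<close>.\<close>
  define r where "r e = (if e = e1 then if x = u1 then f1 else f2 else e)" for e
  have star: "f \<in> edges G \<and> x \<in> f \<longleftrightarrow>
      f \<in> edges G1 \<and> f \<noteq> e1 \<and> x \<in> f \<or> f = f1 \<and> x = u1 \<or> f = f2 \<and> x = v1" for f
    using star_G_iff[OF assms] by (simp add: e1_def f1_def f2_def)
  have unsplice: "unsplice f = (if f \<in> {f1, f2} then e1 else f)" for f
    by (simp add: unsplice_def e1_def f1_def f2_def)
  have e1: "e1 \<in> edges G1" "x \<in> e1 \<longleftrightarrow> x = u1 \<or> x = v1"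
    using edge1 by (auto simp: e1_def)
  have new: "f1 \<notin> edges G1" "f2 \<notin> edges G1"
    using new_edges_notin by (auto simp: f1_def f2_def)
  show ?thesis
  proof (rule bij_betw_byWitness[where f' = r])
    show "\<forall>f\<in>{f \<in> edges G. x \<in> f}. r (unsplice f) = f"
      using new ends(3) by (auto simp: star unsplice r_def)
    show "\<forall>e\<in>{e \<in> edges G1. x \<in> e}. unsplice (r e) = e"
      using new by (auto simp: unsplice r_def)
    show "unsplice ` {f \<in> edges G. x \<in> f} \<subseteq> {e \<in> edges G1. x \<in> e}"
      using e1 new by (auto simp: star unsplice)
    show "r ` {e \<in> edges G1. x \<in> e} \<subseteq> {f \<in> edges G. x \<in> f}"
      using e1 by (auto simp: star r_def)
  qed
qed

lemma degree_G1: "x \<in> verts G1 \<Longrightarrow> degree G x = degree G1 x"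
  unfolding degree_def by (rule bij_betw_same_card[OF bij_betw_star])

lemma degree_G2: "x \<in> verts G2 \<Longrightarrow> degree G x = degree G2 x"
  using splice.degree_G1[OF swap] by (simp add: edge_splice_swap)

section \<open>Connectedness of the spliced graph\<close>

lemma connected_G_if_left:
  assumes "connected_graph G1" "connected_graph G2" "\<not> bridge G1 {u1, v1}"
  shows "connected_graph G"
proof -
  have adj: "adjacency (delete_edges G1 {{u1, v1}}) \<subseteq> adjacency G"
    using old_edge_in_G(1) by (auto simp: adjacency_def delete_edges_def)
  have left: "(x, y) \<in> (adjacency G)\<^sup>*" if "x \<in> verts G1" "y \<in> verts G1" for x y
  proof -
    have "(x, y) \<in> (adjacency (delete_edges G1 {{u1, v1}}))\<^sup>*"
      using connected_delete_non_bridge[OF simple1 assms(1) edge1 assms(3)] that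
      by (simp add: connected_graph_def delete_edges_def)
    then show ?thesis using rtrancl_mono[OF adj] by blast
  qed
  have new: "(u1, u2) \<in> (adjacency G)\<^sup>*" "(v1, v2) \<in> (adjacency G)\<^sup>*"
    by (auto simp: adjacency_def edges_G)
  have detour: "(u2, v2) \<in> (adjacency G)\<^sup>*"
    using new left[of u1 v1] ends adjacency_rtrancl_sym by (meson rtrancl_trans)
  \<comment> \<open>It suffices to simulate single edges of \<open>G2\<close> by walks in
    \<open>G\<close>; only \<open>{u2, v2}\<close> is missing there, and it is replaced by
    \<open>detour\<close>.\<close>
  have "adjacency G2 \<subseteq> (adjacency G)\<^sup>*"
  proof clarify
    fix x y assume "(x, y) \<in> adjacency G2"
    then have xy: "{x, y} \<in> edges G2" by (simp add: adjacency_def)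
    show "(x, y) \<in> (adjacency G)\<^sup>*"
    proof (cases "{x, y} = {u2, v2}")
      case True
      \<comment> \<open>Equality of the unordered pairs allows both orientations, so the reversed
        detour is required too.\<close>
      then show ?thesis using detour adjacency_rtrancl_sym by (auto simp: doubleton_eq_iff)
    next
      case False
      then have "{x, y} \<in> edges G" using xy old_edge_in_G(2) by blast
      then show ?thesis by (auto simp: adjacency_def)
    qed
  qed
  then have right: "(x, y) \<in> (adjacency G)\<^sup>*" if "x \<in> verts G2" "y \<in> verts G2" for x y
    using assms(2) that rtrancl_subset_rtrancl[of "adjacency G2" "adjacency G"]
    unfolding connected_graph_def by blast
  have from_u1: "(u1, x) \<in> (adjacency G)\<^sup>*" if "x \<in> verts G" for x
  proof (cases "x \<in> verts G1")
    case True
    then show ?thesis using left ends(1) by blast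
  next
    case False
    then have "(u2, x) \<in> (adjacency G)\<^sup>*" using that right ends(4) by (simp add: verts_G)
    with new(1) show ?thesis by (rule rtrancl_trans)
  qed
  show ?thesis
    unfolding connected_graph_def
  proof (intro conjI ballI)
    show "verts G \<noteq> {}" using ends(1) by (auto simp: verts_G)
    show "(x, y) \<in> (adjacency G)\<^sup>*" if "x \<in> verts G" "y \<in> verts G" for x y
      using adjacency_rtrancl_sym[OF from_u1[OF that(1)]] from_u1[OF that(2)]
      by (rule rtrancl_trans)
  qed
qed

lemma connected_G:
  assumes "connected_graph G1" "connected_graph G2"
    and "\<not> bridge G1 {u1, v1} \<or> \<not> bridge G2 {u2, v2}"
  shows "connected_graph G"
  using assms connected_G_if_left splice.connected_G_if_left[OF swap]
  by (auto simp: edge_splice_swap)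

section \<open>The coloring of the spliced graph\<close>

abbreviation spliced ::
    "('a element \<Rightarrow> nat) \<Rightarrow> ('a element \<Rightarrow> nat) \<Rightarrow> 'a element \<Rightarrow> nat" where
  "spliced C D \<equiv> splice_coloring G1 C u1 v1 D u2 v2"

lemma spliced_new:
  "spliced C D (Edge {u1, u2}) = C (Edge {u1, v1})"
  "spliced C D (Edge {v1, v2}) = C (Edge {u1, v1})"
  by (auto simp: splice_coloring_def)

lemma spliced_left:
  assumes "z \<in> elements G1"
  shows "spliced C D z = C z"
proof -
  have "z \<noteq> Edge {u1, u2}" "z \<noteq> Edge {v1, v2}"
    using assms new_edges_notin by (auto simp: elements_def)
  then show ?thesis using assms by (simp add: splice_coloring_def)
qed

lemma spliced_right:
  assumes "z \<in> elements G2"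
  shows "spliced C D z = D z"
proof -
  have "z \<noteq> Edge {u1, u2}" "z \<noteq> Edge {v1, v2}"
    using assms new_edges_notin by (auto simp: elements_def)
  moreover have "z \<notin> elements G1"
    using assms edges_disjoint disjoint by (auto simp: elements_def)
  ultimately show ?thesis by (simp add: splice_coloring_def)
qed

text \<open>A new edge has the color of \<open>{u1, v1}\<close>, its image under
  \<open>unsplice\<close>; any other edge at \<open>x\<close> is an edge of \<open>G1\<close> and
  keeps its color.\<close>

lemma spliced_star:
  assumes "x \<in> verts G1" "f \<in> edges G" "x \<in> f"
  shows "spliced C D (Edge f) = C (Edge (unsplice f))"
proof (cases "f \<in> {{u1, u2}, {v1, v2}}")
  case True
  then show ?thesis using spliced_new by (auto simp: unsplice_def)
next
  case False
  then have "f \<in> edges G1" using assms star_G_iff[OF assms(1), of f] by blast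
  then show ?thesis using False spliced_left[of "Edge f"] by (auto simp: unsplice_def elements_def)
qed

text \<open>The definition reads the color of the new edges from the first graph; once the deleted
  edges agree in color, either graph may come first. Only elements of \<open>G\<close> are compared,
  since elsewhere the default values can differ.\<close>

lemma spliced_swap:
  assumes "D (Edge {u2, v2}) = C (Edge {u1, v1})" "z \<in> elements G"
  shows "splice_coloring G2 D u2 v2 C u1 v1 z = spliced C D z"
  using assms(2)
proof (cases rule: elements_G_cases)
  case new
  then show ?thesis using assms(1) by (auto simp: splice_coloring_def insert_commute)
next
  case left
  then show ?thesis using spliced_left splice.spliced_right[OF swap] by metis
next
  case right
  then show ?thesis using spliced_right splice.spliced_left[OF swap] by metis
qed

text \<open>The bijection \<open>unsplice\<close> preserves colors, so a conflict at
  \<open>x\<close> in \<open>G\<close> would already be one at \<open>x\<close> in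
  \<open>G1\<close>.\<close>

lemma spliced_edges_at_left:
  assumes "total_coloring k G1 C" "x \<in> verts G1" "e \<in> edges G" "x \<in> e"
  shows "spliced C D (Vertex x) \<noteq> spliced C D (Edge e)"
    and "f \<in> edges G \<Longrightarrow> x \<in> f \<Longrightarrow> e \<noteq> f \<Longrightarrow> spliced C D (Edge e) \<noteq> spliced C D (Edge f)"
proof -
  note star = bij_betw_star[OF assms(2)]
  have mem: "unsplice f \<in> edges G1" "x \<in> unsplice f" if "f \<in> edges G" "x \<in> f" for f
    using bij_betw_apply[OF star] that by auto
  have "spliced C D (Vertex x) = C (Vertex x)"
    using spliced_left assms(2) by (simp add: elements_def)
  then show "spliced C D (Vertex x) \<noteq> spliced C D (Edge e)"
    using total_coloringD(4)[OF assms(1) mem[OF assms(3,4)]] spliced_star[OF assms(2-4)] by simp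
  assume f: "f \<in> edges G" "x \<in> f" "e \<noteq> f"
  then have "unsplice e \<noteq> unsplice f"
    using bij_betw_imp_inj_on[OF star] assms by (auto dest: inj_onD)
  then have "C (Edge (unsplice e)) \<noteq> C (Edge (unsplice f))"
    using total_coloringD(3)[OF assms(1)] mem f assms(3,4) by blast
  then show "spliced C D (Edge e) \<noteq> spliced C D (Edge f)"
    using spliced_star assms f by simp
qed

text \<open>The vertex \<open>x\<close> lies on one of the two sides; on that of \<open>G2\<close>
  the previous lemma is applied with the graphs exchanged, and \<open>spliced_swap\<close>
  translates the colors back.\<close>

lemma spliced_edges_at:
  assumes "total_coloring k G1 C" "total_coloring k G2 D"
    and "D (Edge {u2, v2}) = C (Edge {u1, v1})"
    and "e \<in> edges G" "x \<in> e"
  shows "spliced C D (Vertex x) \<noteq> spliced C D (Edge e)"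
    and "f \<in> edges G \<Longrightarrow> x \<in> f \<Longrightarrow> e \<noteq> f \<Longrightarrow> spliced C D (Edge e) \<noteq> spliced C D (Edge f)"
proof -
  have x: "x \<in> verts G" using simple_G assms(4,5) by (auto simp: simple_graph_def)
  note right = splice.spliced_edges_at_left[OF swap assms(2), unfolded edge_splice_swap]
  have eq: "splice_coloring G2 D u2 v2 C u1 v1 (Vertex x) = spliced C D (Vertex x)"
    "\<And>g. g \<in> edges G \<Longrightarrow> splice_coloring G2 D u2 v2 C u1 v1 (Edge g) = spliced C D (Edge g)"
    using spliced_swap[where C = C and D = D, OF assms(3)] x by (auto simp: elements_def)
  show "spliced C D (Vertex x) \<noteq> spliced C D (Edge e)"
    using x spliced_edges_at_left(1)[OF assms(1) _ assms(4,5)] right(1)[OF _ assms(4,5)]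
      eq assms(4) unfolding verts_G by (metis UnE)
  assume f: "f \<in> edges G" "x \<in> f" "e \<noteq> f"
  show "spliced C D (Edge e) \<noteq> spliced C D (Edge f)"
    using x spliced_edges_at_left(2)[OF assms(1) _ assms(4,5) f] right(2)[OF _ assms(4,5) f]
      eq assms(4) f(1) unfolding verts_G by (metis UnE)
qed

text \<open>Conflicts involving edges are local to a star and settled by
  \<open>spliced_edges_at\<close>. Between vertices, the only new adjacencies are the two covered by
  the assumption \<open>new\<close>.\<close>

lemma total_coloring_spliced:
  assumes C: "total_coloring k G1 C" and D: "total_coloring k G2 D"
    and "D (Edge {u2, v2}) = C (Edge {u1, v1})"
    and new: "D (Vertex u2) \<noteq> C (Vertex u1)" "D (Vertex v2) \<noteq> C (Vertex v1)"
  shows "total_coloring k G (spliced C D)"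
  unfolding total_coloring_def
proof (intro conjI ballI allI impI)
  fix z assume "z \<in> elements G"
  then show "spliced C D z \<in> {1..k}"
  proof (cases rule: elements_G_cases)
    case new
    have "Edge {u1, v1} \<in> elements G1" using edge1 by (simp add: elements_def)
    with new total_coloringD(1)[OF C] show ?thesis using spliced_new by auto
  next
    case left
    then show ?thesis using total_coloringD(1)[OF C] spliced_left by simp
  next
    case right
    then show ?thesis using total_coloringD(1)[OF D] spliced_right by simp
  qed
next
  have val: "spliced C D (Vertex x) = (if x \<in> verts G1 then C (Vertex x) else D (Vertex x))" for x
    by (auto simp: splice_coloring_def elements_def)
  fix x y assume "{x, y} \<in> edges G"
  then consider "{x, y} \<in> edges G1" | "{x, y} \<in> edges G2"
    | "{x, y} = {u1, u2}" | "{x, y} = {v1, v2}"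
    unfolding edges_G by blast
  then show "spliced C D (Vertex x) \<noteq> spliced C D (Vertex y)"
  proof cases
    case 1
    then show ?thesis using total_coloringD(2)[OF C 1] edges_subset(1)[OF 1] by (simp add: val)
  next
    case 2
    then have "x \<notin> verts G1" "y \<notin> verts G1" using edges_subset(2)[OF 2] disjoint by auto
    then show ?thesis using total_coloringD(2)[OF D 2] by (simp add: val)
  next
    case 3
    then show ?thesis using new ends ends_notin by (auto simp: val doubleton_eq_iff)
  next
    case 4
    then show ?thesis using new ends ends_notin by (auto simp: val doubleton_eq_iff)
  qed
next
  fix e f assume "e \<in> edges G" "f \<in> edges G" and ef: "e \<noteq> f \<and> e \<inter> f \<noteq> {}"
  \<comment> \<open>A common end of the two edges reduces the claim to the star at that
    vertex.\<close>
  moreover obtain x where "x \<in> e" "x \<in> f" using ef by blast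
  ultimately show "spliced C D (Edge e) \<noteq> spliced C D (Edge f)"
    using spliced_edges_at(2)[OF assms(1-3)] by blast
qed (rule spliced_edges_at(1)[OF assms(1-3)])

section \<open>Sizes of the color classes\<close>

lemma card_color_class_spliced:
  assumes "D (Edge {u2, v2}) = C (Edge {u1, v1})"
  shows "card (color_class G (spliced C D) i) = card (color_class G1 C i) + card (color_class G2 D i)"
proof -
  let ?A = "color_class G1 C i" and ?B = "color_class G2 D i"
  let ?old = "{Edge {u1, v1}, Edge {u2, v2}}" and ?new = "{Edge {u1, u2}, Edge {v1, v2}}"
  let ?K = "color_class G (spliced C D) i"
  have fin: "finite ?A" "finite ?B"
    by (rule finite_subset[OF _ finite_elements[OF simple1]], force simp: color_class_def)
      (rule finite_subset[OF _ finite_elements[OF simple2]], force simp: color_class_def)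
  have disj: "?A \<inter> ?B = {}" "(?A \<union> ?B) \<inter> ?new = {}"
    using edges_disjoint disjoint new_edges_notin by (auto simp: color_class_def elements_def)
  have elements: "elements G = (elements G1 \<union> elements G2 - ?old) \<union> ?new"
    unfolding elements_def verts_G edges_G by blast
  \<comment> \<open>The exchange is balanced because the two deleted edges are distinct and so are
    the two new ones.\<close>
  have cards: "card ?old = 2" "card ?new = 2"
  proof -
    have "{u1, v1} \<noteq> {u2, v2}" using edges_disjoint edge1 edge2 by auto
    then show "card ?old = 2" by simp
    have "{u1, u2} \<noteq> {v1, v2}" using ends ends_notin by (auto simp: doubleton_eq_iff)
    then show "card ?new = 2" by simp
  qed
  have K: "?K = (?A \<union> ?B - ?old) \<union> {z \<in> ?new. C (Edge {u1, v1}) = i}"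
    using spliced_left[of _ C D] spliced_right[of _ C D] spliced_new[of C D]
    unfolding color_class_def elements by auto
  have "card ?K = card (?A \<union> ?B)"
  \<comment> \<open>All four exchanged edges share one color: either the class loses two elements
    and gains two, or it is not touched.\<close>
  proof (cases "C (Edge {u1, v1}) = i")
    case True
    have old: "?old \<subseteq> ?A \<union> ?B"
      using True assms edge1 edge2 by (auto simp: color_class_def elements_def)
    have "card ?K = card (?A \<union> ?B - ?old) + card ?new"
    proof -
      have "?K = (?A \<union> ?B - ?old) \<union> ?new"
        unfolding K using True by blast
      moreover have "(?A \<union> ?B - ?old) \<inter> ?new = {}" using disj(2) by blast
      ultimately show ?thesis using fin by (simp only: card_Un_disjoint finite_Diff finite_UnI finite.intros)
    qed
    also have "\<dots> = card (?A \<union> ?B)"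
      \<comment> \<open>Subtraction on naturals is truncated, so \<open>card_mono\<close> has to
        ensure that two elements can indeed be taken away.\<close>
      using card_Diff_subset[OF _ old] card_mono[OF _ old] fin cards by simp
    finally show ?thesis .
  next
    case False
    then have "?old \<inter> (?A \<union> ?B) = {}"
      using assms edge1 edge2 edges_disjoint by (auto simp: color_class_def elements_def)
    then have "?K = ?A \<union> ?B" using K False by auto
    then show ?thesis by simp
  qed
  then show ?thesis using card_Un_disjoint[OF fin disj(1)] by simp
qed

end

section \<open>Choice of the permutation, and the splice of two cubic graphs\<close>

theorem lemma6p1:
  fixes G1 G2 :: "'a ugraph"
    and C1 C2 :: "'a element \<Rightarrow> nat"
    and u1 v1 u2 v2 :: 'a
  assumes "cubic_graph G1" and "cubic_graph G2"
    and "verts G1 \<inter> verts G2 = {}"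
    and "total_coloring 4 G1 C1" and "total_coloring 4 G2 C2"
    and "{u1, v1} \<in> edges G1" and "{u2, v2} \<in> edges G2"
  shows
    "(\<exists>\<pi>. \<pi> permutes {1..4}
        \<and> \<pi> (C2 (Edge {u2, v2})) = C1 (Edge {u1, v1})
        \<and> \<pi> (C2 (Vertex u2)) \<noteq> C1 (Vertex u1)
        \<and> \<pi> (C2 (Vertex v2)) \<noteq> C1 (Vertex v1)) \<and>
     (\<forall>\<pi>. \<pi> permutes {1..4}
        \<and> \<pi> (C2 (Edge {u2, v2})) = C1 (Edge {u1, v1})
        \<and> \<pi> (C2 (Vertex u2)) \<noteq> C1 (Vertex u1)
        \<and> \<pi> (C2 (Vertex v2)) \<noteq> C1 (Vertex v1) \<longrightarrow>
        (let G = edge_splice G1 u1 v1 G2 u2 v2;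
             C = splice_coloring G1 C1 u1 v1 (\<pi> \<circ> C2) u2 v2
         in cubic_graph G
          \<and> (connected_graph G1 \<and> connected_graph G2
               \<and> (\<not> bridge G1 {u1, v1} \<or> \<not> bridge G2 {u2, v2}) \<longrightarrow> connected_graph G)
          \<and> total_coloring 4 G C
          \<and> (\<forall>i\<in>{1..4}. card (color_class G C i)
                = card (color_class G1 C1 i) + card (color_class G2 (\<pi> \<circ> C2) i))))"
proof -
  have simple: "simple_graph G1" "simple_graph G2" using assms(1,2) by (auto simp: cubic_graph_def)
  interpret splice G1 u1 v1 G2 u2 v2
    using simple assms by unfold_locales
  have elements: "Vertex v1 \<in> elements G1" "Edge {u1, v1} \<in> elements G1"
    "Vertex u2 \<in> elements G2" "Edge {u2, v2} \<in> elements G2"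
    using ends edge1 edge2 by (simp_all add: elements_def)
  note colors1 = total_coloringD[OF assms(4)] and colors2 = total_coloringD[OF assms(5)]
  have "C2 (Edge {u2, v2}) \<noteq> C2 (Vertex u2)" "C1 (Edge {u1, v1}) \<noteq> C1 (Vertex v1)"
    using colors2(4)[OF edge2, of u2] colors1(4)[OF edge1, of v1] by auto
  \<comment> \<open>The vertex \<open>u2\<close> is given the color of \<open>v1\<close>, the
    opposite end. This one equation yields both inequalities: \<open>u1\<close> and
    \<open>v1\<close> differ in color, and so do \<open>u2\<close> and \<open>v2\<close>, which
    \<pi> keeps apart. The facts follow the order of the premises of
    \<open>exists_permutes_two_values\<close>.\<close>
  with colors2(1)[OF elements(4)] colors1(1)[OF elements(2)]
    colors2(1)[OF elements(3)] colors1(1)[OF elements(1)]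
  obtain \<pi> where \<pi>: "\<pi> permutes {1..4}"
    "\<pi> (C2 (Edge {u2, v2})) = C1 (Edge {u1, v1})" "\<pi> (C2 (Vertex u2)) = C1 (Vertex v1)"
    by (rule exists_permutes_two_values)
  have "\<pi> (C2 (Vertex u2)) \<noteq> C1 (Vertex u1)"
    using \<pi>(3) colors1(2)[OF edge1] by simp
  moreover have "\<pi> (C2 (Vertex v2)) \<noteq> C1 (Vertex v1)"
    using \<pi>(3) colors2(2)[OF edge2] permutes_inj[OF \<pi>(1)] by (metis injD)
  ultimately have "\<exists>\<pi>. \<pi> permutes {1..4}
        \<and> \<pi> (C2 (Edge {u2, v2})) = C1 (Edge {u1, v1})
        \<and> \<pi> (C2 (Vertex u2)) \<noteq> C1 (Vertex u1)
        \<and> \<pi> (C2 (Vertex v2)) \<noteq> C1 (Vertex v1)"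
    using \<pi>(1,2) by blast
  moreover have "cubic_graph G"
    using assms(1,2) simple_G degree_G1 degree_G2 by (auto simp: cubic_graph_def verts_G)
  ultimately show ?thesis
    unfolding Let_def
  proof (intro conjI allI impI ballI)
    fix \<pi> i
    assume \<pi>: "\<pi> permutes {1..4} \<and> \<pi> (C2 (Edge {u2, v2})) = C1 (Edge {u1, v1})
        \<and> \<pi> (C2 (Vertex u2)) \<noteq> C1 (Vertex u1) \<and> \<pi> (C2 (Vertex v2)) \<noteq> C1 (Vertex v1)"
    then have coloring2: "total_coloring 4 G2 (\<pi> \<circ> C2)"
      using total_coloring_permute[OF assms(5)] by blast
    show "total_coloring 4 G (spliced C1 (\<pi> \<circ> C2))"
      by (rule total_coloring_spliced[OF assms(4) coloring2]) (use \<pi> in simp_all)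
    show "card (color_class G (spliced C1 (\<pi> \<circ> C2)) i)
        = card (color_class G1 C1 i) + card (color_class G2 (\<pi> \<circ> C2) i)"
      by (rule card_color_class_spliced) (use \<pi> in simp)
  qed (use connected_G in blast)+
qed

end
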